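(* Let $\mathbf{w}\in\mathcal{V}$, let $\tau\in\mathfrak{T}(\mathbf{w})$ be a twist, and let $\mathcal{T}$ be a triangulation of $\mathcal{O}(Q_{\mathbf{w}})$ such that $\tau(\mathcal{T})$ is also a triangulation of $\mathcal{O}(Q_{\mathbf{w}})$. Suppose $\mathcal{T}$ can be flipped at a circuit $Z=(Z_+,Z_-)$; write $\mathcal{T}=\mathcal{T}_Z^+$ and let $\mathcal{T}_Z^-$ be the triangulation resulting from the flip. Suppose also that $\tau(\mathcal{T}_Z^+)=\tau(\mathcal{T}_Z^+)_{\tau(Z)}^+$, i.e. that $\tau(\mathcal{T})$ can be flipped at the circuit $\tau(Z)=(\tau(Z_+),\tau(Z_-))$, and let $\tau(\mathcal{T}_Z^+)_{\tau(Z)}^-$ be the result of this flip. Then $$\tau(\mathcal{T}_Z^+)_{\tau(Z)}^-=\tau(\mathcal{T}_Z^-),$$ i.e. flipping $\mathcal{T}$ at $Z$ and then applying $\tau$ gives the same result as applying $\tau$ to $\mathcal{T}$ and then flipping at $\tau(Z)$.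
   Context: A generalized snake word of length $k\ge 0$ is a word $\mathbf{w}=w_0w_1\cdots w_k$ where $w_0=\varepsilon$ is the empty letter and $w_i\in\{L,R\}$ for $1\le i\le k$. $\mathcal{V}$ is the set of generalized snake words that do not contain $LRL$ or $RLR$ as a (contiguous) substring. The generalized snake poset $P(\mathbf{w})$ is defined recursively ($\prec$ denotes a cover relation). $P(\varepsilon)$ is the poset on $\{0,1,2,3\}$ with cover relations $1\prec 0$, $2\prec 0$, $3\prec 1$, $3\prec 2$. For $n\ge 1$, $P(w_0\cdots w_n)$ is $P(w_0\cdots w_{n-1})\cup\{2n+2,2n+3\}$ with the added cover relations $2n+3\prec 2n+1$, $2n+3\prec 2n+2$, and: $2n+2\prec 2n-1$ if ($n=1$ and $w_n=L$) or ($n\ge2$ and $w_{n-1}w_n\in\{RL,LR\}$); $2n+2\prec 2n$ if ($n=1$ and $w_n=R$) or ($n\ge 2$ and $w_{n-1}w_n\in\{LL,RR\}$). $\widehat{P}(\mathbf{w})$ is $P(\mathbf{w})$ with a new minimum $\widehat 0$ and a new maximum $\widehat 1$ adjoined; it is a distributive lattice. $Q_{\mathbf{w}}$ is the poset of meet-irreducible elements of $\widehat P(\mathbf{w})$ (elements $\ne\widehat 1$ covered by exactly one element), with the induced order. The order polytope is $\mathcal{O}(Q)=\{x\in[0,1]^Q: x_i\le x_j \text{ whenever } i<_Q j\}$; its vertices are the indicator vectors of the filters of $Q$. Let $V_0$ be the set of elements of $\widehat P(\mathbf{w})$; identify $x\in V_0$ with the filter $\{q\in Q_{\mathbf{w}}: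 q\ge x\}$ and hence with a vertex of $\mathcal{O}(Q_{\mathbf{w}})$ (a bijection). Squares and ladders. $\mathrm{Sq}(w_0)=\{0,1,2,3\}$; for $i\ge1$, $\mathrm{Sq}(w_i)=\{y,2i+1,2i+2,2i+3\}$, where $y$ is the element covering $2i+2$ in $P(\mathbf{w})$. Let $c_1<\dots<c_{t-1}$ be the indices $c$ with $1\le c\le k-1$ and $w_c\ne w_{c+1}$, and put $c_0=0$, $c_t=k$. For $1\le r\le t$ the ladder $\mathcal{L}^r$ is the subposet of $\widehat P(\mathbf{w})$ on $\bigcup_{j=c_{r-1}}^{c_r}\mathrm{Sq}(w_j)$. Label its elements $x_1,\dots,x_s$ so that its cover relations are exactly $x_{j+2}\prec x_j$ for $1\le j\le s-2$ and $x_{2j}\prec x_{2j-1}$ for $1\le j\le s/2$ (this determines the labeling if the ladder has at least two squares; if $\mathbf{w}=\varepsilon$, take $x_1=0,x_2=1,x_3=2,x_4=3$). The elementary twist $\tau_r$ is the permutation of $V_0$ that exchanges $x_{2j-1}$ and $x_{2j}$ for $1\le j\le s/2$ and fixes all other elements. The twist group $\mathfrak{T}(\mathbf{w})$ is the group of permutations of $V_0$ generated by $\tau_1,\dots,\tau_t$; its elements are called twists. Twists act on subsets of $V_0$ elementwise; for a triangulation $\mathcal{T}$, $\tau(\mathcal{T})$ is the collection of subsets obtained by applying $\tau$ to the vertex set of every simplex of $\mathcal{T}$. For a circuit $Z=(Z_+,Z_-)$, $\tau(Z)=(\tau(Z_+),\tau(Z_-))$ is again a circuit. Triangulations and flips.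 Triangulations of $\mathcal{O}(Q_{\mathbf{w}})$ are triangulations of its vertex set. A circuit $Z$ is a minimal affinely dependent subset of the vertices; its unique affine dependence gives the partition $Z=Z_+\sqcup Z_-$ by sign. The two triangulations of $Z$ have maximal simplices $Z\setminus\{z\}$ with $z\in Z_+$, respectively $z\in Z_-$; call these complexes $K^+$ and $K^-$. A triangulation $\mathcal{T}$ (viewed as a simplicial complex) can be flipped at $Z$ if it contains $K^+$ (orienting $Z$ suitably) and all maximal simplices of $K^+$ have the same link $\mathrm{L}$ in $\mathcal{T}$; the flip replaces $K^+*\mathrm{L}$ by $K^-*\mathrm{L}$. In this situation one writes $\mathcal{T}=\mathcal{T}_Z^+$ and $\mathcal{T}_Z^-$ for the flipped triangulation. *)

theory Defs
  imports
    "HOL-Analysis.Analysis"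
    "HOL-Analysis.Finite_Function_Topology"
    "HOL-Library.Sublist"
    "HOL-Algebra.Bij"
    "HOL-Algebra.Generated_Groups"
begin

section \<open>Generalized snake words and posets\<close>

datatype letter = L | R

text \<open>
  The word \<open>w\<^sub>0 w\<^sub>1 \<dots> w\<^sub>k\<close> is represented by the list \<open>[w\<^sub>1, \<dots>, w\<^sub>k]\<close>; the empty letter \<open>w\<^sub>0\<close>
  is left implicit, so the length of the word is the length of the list.
\<close>

type_synonym word = "letter list"

definition letter_at :: "word \<Rightarrow> nat \<Rightarrow> letter" where
  "letter_at w i = w ! (i - 1)"

definition snake_words_V :: "word set" where
  "snake_words_V = {w. \<not> sublist [L, R, L] w \<and> \<not> sublist [R, L, R] w}"

text \<open>The element covering \<open>2 n + 2\<close> when the letter \<open>w\<^sub>n\<close> is processed (\<open>n \<ge> 1\<close>).\<close>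

definition attach_point :: "word \<Rightarrow> nat \<Rightarrow> nat" where
  "attach_point w n =
     (if n = 1 \<and> letter_at w 1 = L \<or> n \<ge> 2 \<and> letter_at w (n - 1) \<noteq> letter_at w n
      then 2 * n - 1 else 2 * n)"

text \<open>
  \<open>prefix_covers w n\<close> is the cover relation of \<open>P(w\<^sub>0 \<dots> w\<^sub>n)\<close>; a pair \<open>(a, b)\<close> means that \<open>b\<close>
  covers \<open>a\<close>.
\<close>

primrec prefix_covers :: "word \<Rightarrow> nat \<Rightarrow> (nat \<times> nat) set" where
  "prefix_covers w 0 = {(1, 0), (2, 0), (3, 1), (3, 2)}"
| "prefix_covers w (Suc m) = prefix_covers w m \<union>
     (let n = Suc m in
       {(2 * n + 3, 2 * n + 1), (2 * n + 3, 2 * n + 2), (2 * n + 2, attach_point w n)})"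

definition P_covers :: "word \<Rightarrow> (nat \<times> nat) set" where
  "P_covers w = prefix_covers w (length w)"

datatype elt = ZeroHat | OneHat | Pt nat

definition V0 :: "word \<Rightarrow> elt set" where
  "V0 w = {ZeroHat, OneHat} \<union> Pt ` {0..2 * length w + 3}"

text \<open>The order of \<open>P\<close> with new minimum and maximum, meaningful on the carrier \<open>V0 w\<close>.\<close>

fun hat_le :: "word \<Rightarrow> elt \<Rightarrow> elt \<Rightarrow> bool" where
  "hat_le w ZeroHat y = True"
| "hat_le w x OneHat = True"
| "hat_le w (Pt a) (Pt b) = ((a, b) \<in> (P_covers w)\<^sup>*)"
| "hat_le w x y = False"

definition hat_less :: "word \<Rightarrow> elt \<Rightarrow> elt \<Rightarrow> bool" where
  "hat_less w x y \<longleftrightarrow> hat_le w x y \<and> x \<noteq> y"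

definition covered_in :: "word \<Rightarrow> elt set \<Rightarrow> elt \<Rightarrow> elt \<Rightarrow> bool" where
  "covered_in w S x y \<longleftrightarrow> x \<in> S \<and> y \<in> S \<and> hat_less w x y \<and>
     \<not> (\<exists>z\<in>S. hat_less w x z \<and> hat_less w z y)"

definition Q :: "word \<Rightarrow> elt set" where
  "Q w = {x \<in> V0 w. x \<noteq> OneHat \<and> (\<exists>!y. covered_in w (V0 w) x y)}"


section \<open>The order polytope and its vertices\<close>

text \<open>
  A point of \<open>\<real>\<^bsup>Q\<^esup>\<close> is a finitely supported function whose support is contained in \<open>Q w\<close>.
\<close>

definition order_polytope :: "word \<Rightarrow> (elt \<Rightarrow>\<^sub>0 real) set" where
  "order_polytope w = {p. Poly_Mapping.keys p \<subseteq> Q w \<and>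
     (\<forall>i\<in>Q w. 0 \<le> Poly_Mapping.lookup p i \<and> Poly_Mapping.lookup p i \<le> 1) \<and>
     (\<forall>i\<in>Q w. \<forall>j\<in>Q w. hat_less w i j \<longrightarrow> Poly_Mapping.lookup p i \<le> Poly_Mapping.lookup p j)}"

text \<open>The indicator vector of the filter of \<open>Q w\<close> identified with \<open>x \<in> V0 w\<close>.\<close>

definition vertex :: "word \<Rightarrow> elt \<Rightarrow> (elt \<Rightarrow>\<^sub>0 real)" where
  "vertex w x = (\<Sum>q\<in>{q \<in> Q w. hat_le w x q}. Poly_Mapping.single q 1)"


section \<open>Ladders and twists\<close>

definition Sq :: "word \<Rightarrow> nat \<Rightarrow> nat set" where
  "Sq w i = (if i = 0 then {0, 1, 2, 3}
     else {THE y. (2 * i + 2, y) \<in> P_covers w, 2 * i + 1, 2 * i + 2, 2 * i + 3})"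

text \<open>The list \<open>[c\<^sub>0, c\<^sub>1, \<dots>, c\<^sub>t]\<close>, and the number \<open>t\<close> of ladders.\<close>

definition cut_indices :: "word \<Rightarrow> nat list" where
  "cut_indices w =
     0 # filter (\<lambda>c. letter_at w c \<noteq> letter_at w (c + 1)) [1..<length w] @ [length w]"

definition num_ladders :: "word \<Rightarrow> nat" where
  "num_ladders w = length (cut_indices w) - 1"

definition ladder :: "word \<Rightarrow> nat \<Rightarrow> elt set" where
  "ladder w r = Pt ` (\<Union>j\<in>{cut_indices w ! (r - 1)..cut_indices w ! r}. Sq w j)"

text \<open>
  \<open>ladder_labeling w r s x\<close>: the ladder is labelled as \<open>x 1, \<dots>, x s\<close>. A labeling exists and is unique
  unless the ladder is a single square; this happens only for the empty word, where it is prescribed.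
\<close>

definition ladder_labeling :: "word \<Rightarrow> nat \<Rightarrow> nat \<Rightarrow> (nat \<Rightarrow> elt) \<Rightarrow> bool" where
  "ladder_labeling w r s x \<longleftrightarrow>
     bij_betw x {1..s} (ladder w r) \<and>
     (\<forall>a\<in>ladder w r. \<forall>b\<in>ladder w r. covered_in w (ladder w r) a b \<longleftrightarrow>
        (\<exists>j. 1 \<le> j \<and> j + 2 \<le> s \<and> a = x (j + 2) \<and> b = x j) \<or>
        (\<exists>j. 1 \<le> j \<and> 2 * j \<le> s \<and> a = x (2 * j) \<and> b = x (2 * j - 1))) \<and>
     (w = [] \<longrightarrow> x 1 = Pt 0 \<and> x 2 = Pt 1 \<and> x 3 = Pt 2 \<and> x 4 = Pt 3)"

text \<open>
  As in \<^const>\<open>BijGroup\<close>, a permutation of \<open>V0 w\<close> is an extensional function, i.e. it is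
  \<open>undefined\<close> outside \<open>V0 w\<close>.
\<close>

definition is_elementary_twist :: "word \<Rightarrow> nat \<Rightarrow> (elt \<Rightarrow> elt) \<Rightarrow> bool" where
  "is_elementary_twist w r \<tau> \<longleftrightarrow> \<tau> \<in> extensional (V0 w) \<and>
     (\<exists>s x. ladder_labeling w r s x \<and>
        (\<forall>j. 1 \<le> j \<and> 2 * j \<le> s \<longrightarrow>
           \<tau> (x (2 * j - 1)) = x (2 * j) \<and> \<tau> (x (2 * j)) = x (2 * j - 1)) \<and>
        (\<forall>v\<in>V0 w - (\<Union>j\<in>{j. 1 \<le> j \<and> 2 * j \<le> s}. {x (2 * j - 1), x (2 * j)}). \<tau> v = v))"

definition twist_group :: "word \<Rightarrow> (elt \<Rightarrow> elt) set" where
  "twist_group w =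
     generate (BijGroup (V0 w)) {\<tau>. \<exists>r\<in>{1..num_ladders w}. is_elementary_twist w r \<tau>}"

definition twist_complex :: "(elt \<Rightarrow> elt) \<Rightarrow> elt set set \<Rightarrow> elt set set" where
  "twist_complex \<tau> T = (\<lambda>\<sigma>. \<tau> ` \<sigma>) ` T"


section \<open>Triangulations and flips\<close>

text \<open>
  A triangulation is given as the simplicial complex of the vertex sets of all its simplices
  (including the empty one), with vertices named by elements of \<open>V0 w\<close>.
\<close>

definition is_triangulation :: "word \<Rightarrow> elt set set \<Rightarrow> bool" where
  "is_triangulation w T \<longleftrightarrow>
     T \<subseteq> Pow (V0 w) \<and>
     (\<forall>\<sigma>\<in>T. \<not> affine_dependent (vertex w ` \<sigma>)) \<and>
     (\<forall>\<sigma>\<in>T. \<forall>\<rho>. \<rho> \<subseteq> \<sigma> \<longrightarrow> \<rho> \<in> T) \<and>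
     (\<Union>\<sigma>\<in>T. convex hull (vertex w ` \<sigma>)) = order_polytope w \<and>
     (\<forall>\<sigma>\<in>T. \<forall>\<rho>\<in>T. convex hull (vertex w ` \<sigma>) \<inter> convex hull (vertex w ` \<rho>)
        = convex hull (vertex w ` (\<sigma> \<inter> \<rho>)))"

text \<open>
  A circuit with its sign partition. Both \<open>(Zp, Zm)\<close> and \<open>(Zm, Zp)\<close> are allowed, since the affine
  dependence is unique only up to a nonzero factor.
\<close>

definition is_circuit :: "word \<Rightarrow> elt set \<Rightarrow> elt set \<Rightarrow> bool" where
  "is_circuit w Zp Zm \<longleftrightarrow>
     Zp \<union> Zm \<subseteq> V0 w \<and> Zp \<inter> Zm = {} \<and>
     affine_dependent (vertex w ` (Zp \<union> Zm)) \<and>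
     (\<forall>Y. Y \<subset> Zp \<union> Zm \<longrightarrow> \<not> affine_dependent (vertex w ` Y)) \<and>
     (\<exists>c :: elt \<Rightarrow> real.
        (\<Sum>z\<in>Zp \<union> Zm. c z) = 0 \<and> (\<Sum>z\<in>Zp \<union> Zm. c z *\<^sub>R vertex w z) = 0 \<and>
        (\<forall>z\<in>Zp. c z > 0) \<and> (\<forall>z\<in>Zm. c z < 0))"

text \<open>\<open>K\<^sup>+\<close> is \<open>circuit_complex Zp Zm\<close> and \<open>K\<^sup>-\<close> is \<open>circuit_complex Zm Zp\<close>.\<close>

definition circuit_complex :: "elt set \<Rightarrow> elt set \<Rightarrow> elt set set" where
  "circuit_complex Zp Zm = {\<sigma>. \<exists>z\<in>Zp. \<sigma> \<subseteq> (Zp \<union> Zm) - {z}}"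

definition link :: "elt set set \<Rightarrow> elt set \<Rightarrow> elt set set" where
  "link T \<sigma> = {\<rho>\<in>T. \<rho> \<inter> \<sigma> = {} \<and> \<rho> \<union> \<sigma> \<in> T}"

definition join :: "elt set set \<Rightarrow> elt set set \<Rightarrow> elt set set" where
  "join K K' = {\<sigma> \<union> \<rho> | \<sigma> \<rho>. \<sigma> \<in> K \<and> \<rho> \<in> K'}"

definition can_be_flipped :: "word \<Rightarrow> elt set set \<Rightarrow> elt set \<Rightarrow> elt set \<Rightarrow> bool" where
  "can_be_flipped w T Zp Zm \<longleftrightarrow>
     is_circuit w Zp Zm \<and>
     circuit_complex Zp Zm \<subseteq> T \<and>
     (\<exists>Lk. \<forall>z\<in>Zp. link T ((Zp \<union> Zm) - {z}) = Lk)"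

definition common_link :: "elt set set \<Rightarrow> elt set \<Rightarrow> elt set \<Rightarrow> elt set set" where
  "common_link T Zp Zm = (THE Lk. \<forall>z\<in>Zp. link T ((Zp \<union> Zm) - {z}) = Lk)"

text \<open>
  Faces common to \<open>K\<^sup>+ * Lk\<close> and \<open>K\<^sup>- * Lk\<close> are removed and then put back.
\<close>

definition flip :: "elt set set \<Rightarrow> elt set \<Rightarrow> elt set \<Rightarrow> elt set set" where
  "flip T Zp Zm =
     (T - join (circuit_complex Zp Zm) (common_link T Zp Zm)) \<union>
     join (circuit_complex Zm Zp) (common_link T Zp Zm)"

end

(* A twist is a permutation of V0, and a flip is built from a complex by purely set-theoretic
   operations (link, join, difference), all of which commute with injective relabelings. *)
theory Submission
  imports Defs
begin

text \<open>A flip is assembled from links, joins and differences of set systems, and an injective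
  relabeling of the vertices commutes with each of these; \<open>flip_image\<close> states this for
  any map injective on the ground set. By \<open>twist_bij_betw\<close> a twist is such a map: its
  generators are involutions of \<open>V0 w\<close>. Geometry enters through
  \<open>circuit_Zp_nonempty\<close>, which makes the link used by the flip well determined, so that
  it can be transported.\<close>

lemma prefix_covers_fst_le: "(a, b) \<in> prefix_covers w n \<Longrightarrow> a \<le> 2 * n + 3"
  by (induction n) (auto simp: Let_def)

text \<open>Stage \<open>i\<close> introduces \<open>2 * i + 2\<close> with a single upper cover,
  and later stages add covers only below their new, larger elements. This evaluates the definite
  description in \<open>Sq\<close>.\<close>

lemma prefix_covers_even_iff:
  "1 \<le> i \<Longrightarrow> i \<le> n \<Longrightarrow> (2 * i + 2, y) \<in> prefix_covers w n \<longleftrightarrow> y = attach_point w i"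
proof (induction n)
  case (Suc n)
  show ?case
  proof (cases "i = Suc n")
    case True
    then have "(2 * i + 2, y) \<notin> prefix_covers w n"
      using prefix_covers_fst_le[of "2 * i + 2" y w n] by auto
    with True show ?thesis by (auto simp: Let_def)
  next
    case False
    \<comment> \<open>The lower ends of the new covers: the first differs by parity, the second
      because \<open>i\<close> is not \<open>Suc n\<close>.\<close>
    then have "2 * i + 2 \<noteq> 2 * Suc n + 3" "2 * i + 2 \<noteq> 2 * Suc n + 2"
      by presburger+
    then have "(2 * i + 2, y) \<in> prefix_covers w (Suc n) \<longleftrightarrow> (2 * i + 2, y) \<in> prefix_covers w n"
      unfolding prefix_covers.simps Let_def by blast
    with False Suc show ?thesis by simp
  qed
qed simp

lemma Sq_subset:
  assumes "i \<le> length w"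
  shows "Sq w i \<subseteq> {0..2 * length w + 3}"
proof (cases "i = 0")
  case False
  with assms have "(THE y. (2 * i + 2, y) \<in> P_covers w) = attach_point w i"
    unfolding P_covers_def by (subst prefix_covers_even_iff) auto
  then show ?thesis
    using False assms by (auto simp: Sq_def attach_point_def)
qed (auto simp: Sq_def)

lemma ladder_subset_V0:
  assumes "r \<in> {1..num_ladders w}"
  shows "ladder w r \<subseteq> V0 w"
proof -
  have "cut_indices w ! r \<in> set (cut_indices w)"
    using assms by (intro nth_mem) (auto simp: num_ladders_def cut_indices_def)
  then have "cut_indices w ! r \<le> length w"
    by (auto simp: cut_indices_def)
  then have "Sq w j \<subseteq> {0..2 * length w + 3}" if "j \<le> cut_indices w ! r" for j
    using that Sq_subset by simp
  then show ?thesis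
    unfolding ladder_def V0_def by fastforce
qed

text \<open>The defining equations make \<tau> its own inverse on \<open>V0 w\<close>; it stays
  inside \<open>V0 w\<close> because the ladder does.\<close>

lemma elementary_twist_in_Bij:
  assumes "is_elementary_twist w r \<tau>" and "r \<in> {1..num_ladders w}"
  shows "\<tau> \<in> Bij (V0 w)"
proof -
  obtain s x where ext: "\<tau> \<in> extensional (V0 w)" and lab: "ladder_labeling w r s x"
    and swap: "\<And>j. 1 \<le> j \<Longrightarrow> 2 * j \<le> s \<Longrightarrow>
        \<tau> (x (2 * j - 1)) = x (2 * j) \<and> \<tau> (x (2 * j)) = x (2 * j - 1)"
    and fixed: "\<And>v. v \<in> V0 w - (\<Union>j\<in>{j. 1 \<le> j \<and> 2 * j \<le> s}. {x (2 * j - 1), x (2 * j)})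
        \<Longrightarrow> \<tau> v = v"
    using assms(1) unfolding is_elementary_twist_def by auto
  have "x ` {1..s} \<subseteq> V0 w"
    using lab ladder_subset_V0[OF assms(2)] by (auto simp: ladder_labeling_def bij_betw_def)
  then have mem: "x j \<in> V0 w" if "1 \<le> j" "j \<le> s" for j
    using that by auto
  have inv: "\<tau> v \<in> V0 w \<and> \<tau> (\<tau> v) = v" if v: "v \<in> V0 w" for v
  proof (cases "v \<in> (\<Union>j\<in>{j. 1 \<le> j \<and> 2 * j \<le> s}. {x (2 * j - 1), x (2 * j)})")
    case True
    then obtain j where j: "1 \<le> j" "2 * j \<le> s" "v = x (2 * j - 1) \<or> v = x (2 * j)"
      by auto
    then show ?thesis
      using swap[OF j(1,2)] mem[of "2 * j"] mem[of "2 * j - 1"] by auto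
  next
    case False
    then show ?thesis using fixed v by auto
  qed
  then have "bij_betw \<tau> (V0 w) (V0 w)"
    by (intro bij_betwI[where g = \<tau>]) auto
  with ext show ?thesis by (simp add: Bij_def)
qed

lemma twist_bij_betw:
  assumes "\<tau> \<in> twist_group w"
  shows "bij_betw \<tau> (V0 w) (V0 w)"
proof -
  have "\<tau> \<in> carrier (BijGroup (V0 w))"
    by (rule group.generate_in_carrier[OF group_BijGroup _ assms[unfolded twist_group_def]])
      (auto simp: BijGroup_def elementary_twist_in_Bij)
  then show ?thesis by (simp add: BijGroup_def Bij_def)
qed

text \<open>Otherwise the coefficients, all negative, sum to zero, so the circuit is empty; but the
  empty set is affinely independent.\<close>

lemma circuit_Zp_nonempty:
  assumes "is_circuit w Zp Zm"
  shows "Zp \<noteq> {}"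
proof
  assume empty: "Zp = {}"
  obtain c where c: "(\<Sum>z\<in>Zm. c z) = (0 :: real)" "\<forall>z\<in>Zm. c z < 0"
    using assms empty unfolding is_circuit_def by auto
  have "finite (V0 w)" by (simp add: V0_def)
  then have "finite Zm"
    using assms finite_subset unfolding is_circuit_def by blast
  with c have "Zm = {}"
    using sum_strict_mono[of Zm c "\<lambda>_. 0"] by auto
  with empty assms show False by (simp add: is_circuit_def)
qed

text \<open>Taking images is injective on subsets of \<open>V\<close>, so membership in
  \<open>T\<close> and disjointness are reflected as well as preserved.\<close>

lemma link_image:
  assumes inj: "inj_on f V" and T: "T \<subseteq> Pow V" and \<sigma>: "\<sigma> \<subseteq> V"
  shows "link ((`) f ` T) (f ` \<sigma>) = (`) f ` link T \<sigma>"
proof -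
  have iff: "f ` \<rho> \<inter> f ` \<sigma> = {} \<and> f ` \<rho> \<union> f ` \<sigma> \<in> (`) f ` T
      \<longleftrightarrow> \<rho> \<inter> \<sigma> = {} \<and> \<rho> \<union> \<sigma> \<in> T" if "\<rho> \<in> T" for \<rho>
  proof -
    have \<rho>: "\<rho> \<subseteq> V" using that T by blast
    then have "f ` (\<rho> \<union> \<sigma>) \<in> (`) f ` T \<longleftrightarrow> \<rho> \<union> \<sigma> \<in> T"
      by (intro inj_on_image_mem_iff[OF inj_on_image_Pow[OF inj] _ T]) (use \<sigma> in simp)
    moreover have "f ` (\<rho> \<inter> \<sigma>) = f ` \<rho> \<inter> f ` \<sigma>"
      by (rule inj_on_image_Int[OF inj \<rho> \<sigma>])
    ultimately show ?thesis by (metis image_Un image_is_empty)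
  qed
  have "link ((`) f ` T) (f ` \<sigma>)
      = (`) f ` {\<rho> \<in> T. f ` \<rho> \<inter> f ` \<sigma> = {} \<and> f ` \<rho> \<union> f ` \<sigma> \<in> (`) f ` T}"
    unfolding link_def by blast
  also have "\<dots> = (`) f ` link T \<sigma>"
    by (simp only: link_def iff cong: conj_cong)
  finally show ?thesis .
qed

lemma circuit_complex_image:
  assumes inj: "inj_on f V" and "Zp \<subseteq> V" and "Zm \<subseteq> V"
  shows "circuit_complex (f ` Zp) (f ` Zm) = (`) f ` circuit_complex Zp Zm"
proof -
  have "f ` (Zp \<union> Zm - {z}) = f ` Zp \<union> f ` Zm - {f z}" if "z \<in> Zp" for z
    using inj_on_image_set_diff[OF inj, of "Zp \<union> Zm" "{z}"] that assms(2,3) by auto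
  \<comment> \<open>As a union of power sets, the complex visibly commutes with images.\<close>
  moreover have "circuit_complex A B = (\<Union>z\<in>A. Pow (A \<union> B - {z}))" for A B
    by (auto simp: circuit_complex_def)
  ultimately show ?thesis
    by (simp add: image_UN image_Pow_surj)
qed

lemma join_image:
  fixes f :: "elt \<Rightarrow> elt"
  shows "join ((`) f ` K) ((`) f ` K') = (`) f ` join K K'"
proof -
  have "join A B = (\<Union>\<sigma>\<in>A. (\<union>) \<sigma> ` B)" for A B :: "elt set set"
    by (auto simp: join_def)
  then show ?thesis by (simp add: image_UN image_image image_Un)
qed

text \<open>With \<open>Zp\<close> empty every \<open>Lk\<close> would satisfy the condition
  vacuously, and \<open>THE\<close> would be unspecified.\<close>

lemma common_link_eq:
  assumes "\<And>z. z \<in> Zp \<Longrightarrow> link T (Zp \<union> Zm - {z}) = Lk" and "Zp \<noteq> {}"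
  shows "common_link T Zp Zm = Lk"
  unfolding common_link_def
proof (rule the_equality)
  show "Lk' = Lk" if "\<forall>z\<in>Zp. link T (Zp \<union> Zm - {z}) = Lk'" for Lk'
    using assms that by (metis ex_in_conv)
qed (use assms(1) in blast)

lemma flip_image:
  assumes inj: "inj_on f V" and T: "T \<subseteq> Pow V" and Z: "Zp \<subseteq> V" "Zm \<subseteq> V" "Zp \<noteq> {}"
    and Lk: "\<And>z. z \<in> Zp \<Longrightarrow> link T (Zp \<union> Zm - {z}) = Lk"
  shows "flip ((`) f ` T) (f ` Zp) (f ` Zm) = (`) f ` flip T Zp Zm"
proof -
  have "link ((`) f ` T) (f ` Zp \<union> f ` Zm - {f z}) = (`) f ` Lk" if "z \<in> Zp" for z
  proof -
    \<comment> \<open>Each maximal simplex of the image circuit complex is the image of one of the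
      original, so \<open>link_image\<close> applies.\<close>
    have "f ` Zp \<union> f ` Zm - {f z} = f ` (Zp \<union> Zm - {z})"
      using inj_on_image_set_diff[OF inj, of "Zp \<union> Zm" "{z}"] that Z by auto
    moreover have "Zp \<union> Zm - {z} \<subseteq> V"
      using Z by blast
    ultimately show ?thesis
      by (simp only: link_image[OF inj T] Lk[OF that])
  qed
  then have link': "common_link ((`) f ` T) (f ` Zp) (f ` Zm) = (`) f ` Lk"
    using Z(3) by (intro common_link_eq) blast+
  have link: "common_link T Zp Zm = Lk"
    by (rule common_link_eq[OF Lk Z(3)])
  \<comment> \<open>Images respect a set difference only where the map is injective, so the removed
    join must be shown to consist of subsets of \<open>V\<close>.\<close>
  have "Lk \<subseteq> Pow V"
    using Z(3) Lk T unfolding link_def by blast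
  then have "join (circuit_complex Zp Zm) Lk \<subseteq> Pow V"
    using Z unfolding join_def circuit_complex_def by blast
  then have "(`) f ` (T - join (circuit_complex Zp Zm) Lk)
      = (`) f ` T - (`) f ` join (circuit_complex Zp Zm) Lk"
    using T by (intro inj_on_image_set_diff[OF inj_on_image_Pow[OF inj]]) auto
  then show ?thesis
    unfolding flip_def link link' circuit_complex_image[OF inj Z(1,2)]
      circuit_complex_image[OF inj Z(2,1)] join_image
    by (simp add: image_Un)
qed

theorem theorem5p6:
  fixes w :: word and \<tau> :: "elt \<Rightarrow> elt" and T :: "elt set set" and Zp Zm :: "elt set"
  assumes "w \<in> snake_words_V"
    and "\<tau> \<in> twist_group w"
    and "is_triangulation w T"
    and "is_triangulation w (twist_complex \<tau> T)"
    and "can_be_flipped w T Zp Zm"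
    and "can_be_flipped w (twist_complex \<tau> T) (\<tau> ` Zp) (\<tau> ` Zm)"
  shows "flip (twist_complex \<tau> T) (\<tau> ` Zp) (\<tau> ` Zm) = twist_complex \<tau> (flip T Zp Zm)"
proof -
  have circ: "is_circuit w Zp Zm"
    using assms(5) by (simp add: can_be_flipped_def)
  obtain Lk where Lk: "\<And>z. z \<in> Zp \<Longrightarrow> link T (Zp \<union> Zm - {z}) = Lk"
    using assms(5) unfolding can_be_flipped_def by auto
  have inj: "inj_on \<tau> (V0 w)"
    using twist_bij_betw[OF assms(2)] by (rule bij_betw_imp_inj_on)
  have T: "T \<subseteq> Pow (V0 w)"
    using assms(3) by (simp add: is_triangulation_def)
  have Z: "Zp \<subseteq> V0 w" "Zm \<subseteq> V0 w"
    using circ by (auto simp: is_circuit_def)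
  show ?thesis
    unfolding twist_complex_def by (rule flip_image[OF inj T Z circuit_Zp_nonempty[OF circ] Lk])
qed

end
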